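(* Let $H$ and $H'$ be two graphs with the same finite vertex set $V_H=V_{H'}=V$. Then $\mathrm{pPol}(E_H)\subseteq \mathrm{pPol}(E_{H'})$ if and only if $H=H'$ or $E_{H'}=\emptyset$.
   Context: All graphs are finite, simple, undirected and loopless; the edge set $E_H$ of a graph $H$ is viewed as a symmetric irreflexive binary relation on $V_H$. For a relation $R\subseteq V^n$, a partial function $f:\mathrm{dom}(f)\to V$ with $\mathrm{dom}(f)\subseteq V^m$ is a partial polymorphism of $R$ if for every $n\times m$ matrix $A$ over $V$ whose columns all belong to $R$ and whose rows all belong to $\mathrm{dom}(f)$, the column obtained by applying $f$ to each row belongs to $R$. $\mathrm{pPol}(R)$ denotes the set of all partial polymorphisms of $R$. *)

theory Defs
  imports "Graph_Theory.Pair_Digraph"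
begin

text \<open>Tuples in \<open>V\<^sup>k\<close> are lists of length \<open>k\<close> over \<open>V\<close>.\<close>

definition tuples :: "'a set \<Rightarrow> nat \<Rightarrow> 'a list set" where
  "tuples V k = {xs. length xs = k \<and> set xs \<subseteq> V}"

text \<open>An \<open>n \<times> m\<close> matrix is a function \<open>A\<close> of which only the entries \<open>A i j\<close> with
  \<open>i < n\<close> and \<open>j < m\<close> are relevant.\<close>

definition mrow :: "nat \<Rightarrow> (nat \<Rightarrow> nat \<Rightarrow> 'a) \<Rightarrow> nat \<Rightarrow> 'a list" where
  "mrow m A i = map (\<lambda>j. A i j) [0..<m]"

definition mcol :: "nat \<Rightarrow> (nat \<Rightarrow> nat \<Rightarrow> 'a) \<Rightarrow> nat \<Rightarrow> 'a list" where
  "mcol n A j = map (\<lambda>i. A i j) [0..<n]"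

definition partial_operation :: "'a set \<Rightarrow> nat \<Rightarrow> ('a list \<rightharpoonup> 'a) \<Rightarrow> bool" where
  "partial_operation V m f \<longleftrightarrow> dom f \<subseteq> tuples V m \<and> ran f \<subseteq> V"

definition partial_polymorphism ::
    "'a set \<Rightarrow> nat \<Rightarrow> 'a list set \<Rightarrow> nat \<Rightarrow> ('a list \<rightharpoonup> 'a) \<Rightarrow> bool" where
  "partial_polymorphism V n R m f \<longleftrightarrow>
     partial_operation V m f \<and>
     (\<forall>A. (\<forall>i<n. \<forall>j<m. A i j \<in> V) \<longrightarrow>
          (\<forall>j<m. mcol n A j \<in> R) \<longrightarrow>
          (\<forall>i<n. mrow m A i \<in> dom f) \<longrightarrow>
          map (\<lambda>i. the (f (mrow m A i))) [0..<n] \<in> R)"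

text \<open>The arity is recorded with each function, since the domain alone does not determine it
  when it is empty.\<close>

definition pPol :: "'a set \<Rightarrow> nat \<Rightarrow> 'a list set \<Rightarrow> (nat \<times> ('a list \<rightharpoonup> 'a)) set" where
  "pPol V n R = {(m, f). partial_polymorphism V n R m f}"

definition edge_relation :: "'a pair_pre_digraph \<Rightarrow> 'a list set" where
  "edge_relation H = {[u, v] | u v. (u, v) \<in> parcs H}"

end

theory Submission
  imports Defs
begin

text \<open>If \<open>E\<^bsub>H'\<^esub>\<close> is nonempty, unary partial maps defined on just two vertices already separate the
  polymorphisms. If \<open>uv\<close> is an edge of \<open>H'\<close> but not of \<open>H\<close>, then \<open>u, v \<mapsto> u\<close> preserves \<open>E\<^bsub>H\<^esub>\<close>
  vacuously, yet creates a loop in \<open>H'\<close>. Hence \<open>E\<^bsub>H'\<^esub> \<subseteq> E\<^bsub>H\<^esub>\<close>; if \<open>ab\<close> is an edge of \<open>H\<close> but not of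
  \<open>H'\<close>, and \<open>uv\<close> is any edge of \<open>H'\<close>, then \<open>u \<mapsto> a, v \<mapsto> b\<close> preserves \<open>E\<^bsub>H\<^esub>\<close> but not \<open>E\<^bsub>H'\<^esub>\<close>.\<close>

lemma pair_in_edge_relation [simp]: "[u, v] \<in> edge_relation H \<longleftrightarrow> (u, v) \<in> parcs H"
  by (auto simp: edge_relation_def)

lemma pair_graph_sym:
  assumes "pair_graph G" "(u, v) \<in> parcs G"
  shows "(v, u) \<in> parcs G"
proof -
  interpret pair_graph G by (fact assms)
  show ?thesis using assms(2) by (rule arcs_symmetric)
qed

lemma pair_graph_no_loop:
  assumes "pair_graph G"
  shows "(u, u) \<notin> parcs G"
proof -
  interpret pair_graph G by (fact assms)
  show ?thesis using no_loops' by blast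
qed

text \<open>With two rows, a column is just a pair of vertices, so \<open>f\<close> has to send
  componentwise adjacent rows to adjacent vertices.\<close>

lemma partial_polymorphism_edge_relation_iff:
  "partial_polymorphism V 2 (edge_relation G) m f \<longleftrightarrow>
     partial_operation V m f \<and>
     (\<forall>A. (\<forall>j<m. A 0 j \<in> V \<and> A 1 j \<in> V \<and> (A 0 j, A 1 j) \<in> parcs G) \<longrightarrow>
          mrow m A 0 \<in> dom f \<longrightarrow> mrow m A 1 \<in> dom f \<longrightarrow>
          (the (f (mrow m A 0)), the (f (mrow m A 1))) \<in> parcs G)"
proof -
  have "[0..<2] = [0, 1::nat]" by (simp add: upt_rec)
  moreover have "(\<forall>i<2. P i) \<longleftrightarrow> P 0 \<and> P 1" for P :: "nat \<Rightarrow> bool"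
    by (auto simp: less_2_cases_iff)
  ultimately show ?thesis
    unfolding partial_polymorphism_def mcol_def by simp blast
qed

text \<open>Without loops, only uv and vu can be edges inside the domain, and by symmetry both
  impose the same condition.\<close>

lemma unary_two_point_map_in_pPol_iff:
  assumes G: "pair_graph G" "pverts G = V"
    and V: "u \<in> V" "v \<in> V" "a \<in> V" "b \<in> V" and "u \<noteq> v"
  shows "(1, [[u] \<mapsto> a, [v] \<mapsto> b]) \<in> pPol V 2 (edge_relation G) \<longleftrightarrow>
         ((u, v) \<in> parcs G \<longrightarrow> (a, b) \<in> parcs G)"
    (is "(1, ?f) \<in> _ \<longleftrightarrow> ?preserves")
proof
  assume "(1, ?f) \<in> pPol V 2 (edge_relation G)"
  then have *: "partial_polymorphism V 2 (edge_relation G) 1 ?f"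
    by (simp add: pPol_def)
  \<comment> \<open>The test matrix has the single column uv; its rows \<open>[u]\<close> and
    \<open>[v]\<close> are sent to a and b.\<close>
  show ?preserves
    using *[unfolded partial_polymorphism_edge_relation_iff, THEN conjunct2, rule_format,
        of "\<lambda>i j. if i = 0 then u else v"] V \<open>u \<noteq> v\<close>
    by (simp add: mrow_def)
next
  assume preserves: ?preserves
  have "(the (?f [x]), the (?f [y])) \<in> parcs G"
    if xy: "(x, y) \<in> parcs G" "[x] \<in> dom ?f" "[y] \<in> dom ?f" for x y
  proof -
    have "x \<noteq> y" using xy(1) pair_graph_no_loop[OF G(1)] by blast
    then consider "x = u" "y = v" | "x = v" "y = u"
      using xy(2,3) by (auto split: if_splits)
    then show ?thesis
    proof cases
      case 1
      then show ?thesis using xy(1) preserves \<open>u \<noteq> v\<close> by simp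
    next
      case 2
      then have "(b, a) \<in> parcs G"
        using xy(1) preserves pair_graph_sym[OF G(1)] by blast
      then show ?thesis using 2 \<open>u \<noteq> v\<close> by simp
    qed
  qed
  moreover have "partial_operation V 1 ?f"
    using V by (auto simp: partial_operation_def tuples_def ran_def)
  ultimately show "(1, ?f) \<in> pPol V 2 (edge_relation G)"
    unfolding pPol_def partial_polymorphism_edge_relation_iff
    by (simp add: mrow_def)
qed

text \<open>For positive arity no matrix has its columns in the empty relation; only arity 0 draws
  on \<open>G\<close>.\<close>

lemma pPol_subset_of_no_edges:
  assumes "pair_graph G" "parcs G' = {}"
  shows "pPol V 2 (edge_relation G) \<subseteq> pPol V 2 (edge_relation G')"
proof (clarsimp simp: pPol_def)
  fix m f assume f: "partial_polymorphism V 2 (edge_relation G) m f"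
  show "partial_polymorphism V 2 (edge_relation G') m f"
  proof (cases "m = 0")
    case True
    \<comment> \<open>With no columns to constrain it, a defined nullary operation would create a loop in \<open>G\<close>.\<close>
    then have "[] \<notin> dom f"
      using f pair_graph_no_loop[OF assms(1)]
      by (auto simp: partial_polymorphism_edge_relation_iff mrow_def)
    then show ?thesis
      using f True by (auto simp: partial_polymorphism_edge_relation_iff mrow_def)
  next
    case False
    then show ?thesis
      using f assms(2) by (auto simp: partial_polymorphism_edge_relation_iff)
  qed
qed

theorem theorem3p1:
  fixes H H' :: "'a pair_pre_digraph" and V :: "'a set"
  assumes "pair_graph H" and "pair_graph H'"
    and "pverts H = V" and "pverts H' = V"
  shows "pPol V 2 (edge_relation H) \<subseteq> pPol V 2 (edge_relation H') \<longleftrightarrow>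
         H = H' \<or> parcs H' = {}"
proof
  assume sub: "pPol V 2 (edge_relation H) \<subseteq> pPol V 2 (edge_relation H')"
  have in_V: "u \<in> V \<and> v \<in> V \<and> u \<noteq> v" if "(u, v) \<in> parcs G" "pair_graph G" "pverts G = V" for G u v
  proof -
    interpret pair_graph G by (fact that(2))
    show ?thesis
      using that in_arcsD1[OF that(1)] in_arcsD2[OF that(1)] pair_graph_no_loop[of G u] by blast
  qed
  note in_VH = in_V[OF _ assms(1,3)] and in_VH' = in_V[OF _ assms(2,4)]
  have transfer: "(u, v) \<in> parcs H' \<longrightarrow> (a, b) \<in> parcs H'"
    if "(u, v) \<in> parcs H \<longrightarrow> (a, b) \<in> parcs H" "u \<in> V" "v \<in> V" "a \<in> V" "b \<in> V" "u \<noteq> v"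
    for u v a b
    using sub that(1) unary_two_point_map_in_pPol_iff[OF assms(1,3) that(2-6)]
      unary_two_point_map_in_pPol_iff[OF assms(2,4) that(2-6)] by blast
  \<comment> \<open>Otherwise the premise of \<open>transfer\<close> holds vacuously for a = b = u,
    giving a loop in \<open>H'\<close>.\<close>
  have "(u, v) \<in> parcs H" if "(u, v) \<in> parcs H'" for u v
    using that in_VH'[of u v] transfer[of u v u u] pair_graph_no_loop[OF assms(2)] by blast
  then have le: "parcs H' \<subseteq> parcs H" by auto
  have "(a, b) \<in> parcs H'" if "(u, v) \<in> parcs H'" "(a, b) \<in> parcs H" for u v a b
    using that in_VH'[of u v] in_VH[of a b] transfer[of u v a b] by blast
  then have "parcs H \<subseteq> parcs H'" if "parcs H' \<noteq> {}"
    using that by auto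
  with le have "parcs H = parcs H'" if "parcs H' \<noteq> {}"
    using that by blast
  \<comment> \<open>The records have no fields besides vertices and arcs.\<close>
  then show "H = H' \<or> parcs H' = {}"
    using assms(3,4) by (cases H; cases H') auto
next
  assume "H = H' \<or> parcs H' = {}"
  then show "pPol V 2 (edge_relation H) \<subseteq> pPol V 2 (edge_relation H')"
    using pPol_subset_of_no_edges[OF assms(1)] by blast
qed

end
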